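(* Let $(X,d)$ be a compact metric space, $f: X \to X$ a continuous minimal map, $k \geqslant 2$ and $A: X\to GL(k,\mathbb R)$ a continuous map (linear cocycle). For $x\in X$ and $n\in\mathbb{N}$ put $A^n(x)= A(f^{n-1}(x)) \cdots A(f(x)) A(x)$. Then either the limit $\lim_{n\to+\infty} \frac1n \log \|A^n(x)\|$ exists for every $x\in X$, $$\inf_{x\in X} \lim_{n\to+\infty} \frac1n \log \|A^n(x)\| = \sup_{x\in X} \lim_{n\to+\infty} \frac1n \log \|A^n(x)\|,$$ and this common value is the unique possible largest Lyapunov exponent of $A$ associated to any $f$-invariant Borel probability measure; or there exists a Baire residual subset $\mathcal R \subset X$ such that $$\liminf_{n\to+\infty} \frac1n \log \|A^n(x)\| < \limsup_{n\to+\infty} \frac1n \log \|A^n(x)\| \qquad \forall\, x \in \mathcal R.$$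
   Context: A continuous map $f:X\to X$ is minimal if the forward orbit of every $x\in X$ is dense in $X$. The largest Lyapunov exponent of $A$ associated to an $f$-invariant ergodic Borel probability measure $\mu$ is the constant $\lambda^+(A,\mu)$ such that $\lambda^+(A,\mu)= \lim_{n\to+\infty} \frac1n \log \|A^n(x)\|$ for $\mu$-a.e. $x$; for a general $f$-invariant probability measure $\mu$ the largest Lyapunov exponent at $x$ is this limit, which exists for $\mu$-a.e. $x$. A subset of a topological space is Baire residual if it contains a countable intersection of open dense subsets. *)

theory Defs
  imports "HOL-Probability.Probability"
begin

definition minimal_map :: "('a::topological_space \<Rightarrow> 'a) \<Rightarrow> bool" where
  "minimal_map f \<longleftrightarrow> (\<forall>x. closure (range (\<lambda>n. (f ^^ n) x)) = UNIV)"

definition residual :: "'a::topological_space set \<Rightarrow> bool" where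
  "residual R \<longleftrightarrow>
     (\<exists>\<U>. countable \<U> \<and> (\<forall>U\<in>\<U>. open U \<and> closure U = UNIV) \<and> \<Inter>\<U> \<subseteq> R)"

fun cocycle :: "('a \<Rightarrow> real^'k^'k) \<Rightarrow> ('a \<Rightarrow> 'a) \<Rightarrow> nat \<Rightarrow> 'a \<Rightarrow> real^'k^'k" where
  "cocycle A f 0 x = mat 1"
| "cocycle A f (Suc n) x = A ((f ^^ n) x) ** cocycle A f n x"

text \<open>
  The operator norm is written with \<^const>\<open>onorm\<close>, because \<^const>\<open>norm\<close> on
  the type of matrices is the Frobenius norm. The value at \<open>n = 0\<close> is irrelevant.
\<close>

definition growth_rate :: "('a \<Rightarrow> real^'k^'k) \<Rightarrow> ('a \<Rightarrow> 'a) \<Rightarrow> 'a \<Rightarrow> nat \<Rightarrow> real" where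
  "growth_rate A f x n = 1 / real n * ln (onorm ((*v) (cocycle A f n x)))"

definition invariant_prob :: "('a::topological_space \<Rightarrow> 'a) \<Rightarrow> 'a measure \<Rightarrow> bool" where
  "invariant_prob f \<mu> \<longleftrightarrow> prob_space \<mu> \<and> sets \<mu> = sets borel \<and>
     f \<in> measurable \<mu> \<mu> \<and> distr \<mu> \<mu> f = \<mu>"

definition ergodic_prob :: "('a::topological_space \<Rightarrow> 'a) \<Rightarrow> 'a measure \<Rightarrow> bool" where
  "ergodic_prob f \<mu> \<longleftrightarrow> invariant_prob f \<mu> \<and>
     (\<forall>B\<in>sets \<mu>. f -` B = B \<longrightarrow> measure \<mu> B = 0 \<or> measure \<mu> B = 1)"

definition largest_exponent_at ::
  "('a \<Rightarrow> real^'k^'k) \<Rightarrow> ('a \<Rightarrow> 'a) \<Rightarrow> 'a \<Rightarrow> real \<Rightarrow> bool" where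
  "largest_exponent_at A f x c \<longleftrightarrow> growth_rate A f x \<longlonglongrightarrow> c"

text \<open>The largest exponent of an ergodic measure; used only for ergodic \<open>\<mu>\<close>.\<close>

definition largest_exponent ::
  "('a \<Rightarrow> real^'k^'k) \<Rightarrow> ('a \<Rightarrow> 'a) \<Rightarrow> 'a measure \<Rightarrow> real \<Rightarrow> bool" where
  "largest_exponent A f \<mu> c \<longleftrightarrow> (AE x in \<mu>. largest_exponent_at A f x c)"

end

theory Submission
  imports Defs
begin

text \<open>
  Write \<open>a\<^sub>n x = ln \<parallel>A\<^sup>n x\<parallel>\<close>. By compactness, \<open>A x\<close> distorts lengths by a factor
  in a fixed interval \<open>[m, M]\<close> with \<open>m > 0\<close>. Passing from \<open>x\<close> to \<open>f x\<close> amounts to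
  removing one factor of the matrix product on the right and adding one on the left,
  so \<open>a\<^sub>n (f x) - a\<^sub>n x\<close> is bounded uniformly in \<open>n\<close>, and the lower and upper growth
  rates, the liminf and limsup of \<open>a\<^sub>n x / n\<close>, are constant along orbits.

  Let \<open>\<alpha>\<close> be the infimum of the lower and \<open>\<beta>\<close> the supremum of the upper growth rates.
  If \<open>\<alpha> = \<beta>\<close>, the growth rate converges at every point to the same number, which is
  finite because \<open>\<bar>a\<^sub>n\<bar> / n\<close> is bounded; every assertion about measures is then immediate,
  since the convergence holds everywhere and not just almost everywhere.
  If \<open>\<alpha> < c < d < \<beta>\<close>, some point has lower growth rate below \<open>c\<close>, hence so has its whole
  orbit, which is dense. For each \<open>N\<close> the open set of points with \<open>a\<^sub>n x / n < c\<close> for some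
  \<open>n \<ge> N\<close> contains that orbit, so it is dense too; the intersection over \<open>N\<close> consists of points
  with lower growth rate at most \<open>c\<close> (lemma \<open>residual_liminf_le\<close>). Symmetrically,
  the upper growth rate is at least \<open>d\<close> on a residual set, and the intersection of
  the two residual sets is the set of the second alternative.
\<close>

section \<open>Residual sets and asymptotically invariant sequences\<close>

lemma residual_Int:
  assumes "residual R" "residual S"
  shows "residual (R \<inter> S)"
proof -
  obtain U V where "countable U" "\<forall>W\<in>U. open W \<and> closure W = UNIV" "\<Inter>U \<subseteq> R"
    "countable V" "\<forall>W\<in>V. open W \<and> closure W = UNIV" "\<Inter>V \<subseteq> S"
    using assms unfolding residual_def by metis
  then show ?thesis
    unfolding residual_def by (intro exI[of _ "U \<union> V"]) auto
qed

lemma residual_mono: "residual R \<Longrightarrow> R \<subseteq> S \<Longrightarrow> residual S"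
  unfolding residual_def by (meson subset_trans)

lemma asymptotic_invariance_iterate:
  fixes \<phi> :: "nat \<Rightarrow> 'a \<Rightarrow> real"
  assumes "\<And>x. (\<lambda>n. \<phi> n (f x) - \<phi> n x) \<longlonglongrightarrow> 0"
  shows "(\<lambda>n. \<phi> n ((f ^^ k) x) - \<phi> n x) \<longlonglongrightarrow> 0"
proof (induction k)
  case (Suc k)
  show ?case
    using tendsto_add[OF assms[of "(f ^^ k) x"] Suc] by simp
qed simp

lemma liminf_constant_on_orbit:
  fixes \<phi> :: "nat \<Rightarrow> 'a \<Rightarrow> real"
  assumes "\<And>x. (\<lambda>n. \<phi> n (f x) - \<phi> n x) \<longlonglongrightarrow> 0"
  shows "liminf (\<lambda>n. ereal (\<phi> n ((f ^^ k) x))) = liminf (\<lambda>n. ereal (\<phi> n x))"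
proof -
  have "(\<lambda>n. ereal (\<phi> n ((f ^^ k) x) - \<phi> n x)) \<longlonglongrightarrow> ereal 0"
    using asymptotic_invariance_iterate[where \<phi> = \<phi> and f = f, OF assms] by (simp add: lim_ereal)
  then have "liminf (\<lambda>n. ereal (\<phi> n ((f ^^ k) x) - \<phi> n x) + ereal (\<phi> n x))
      = ereal 0 + liminf (\<lambda>n. ereal (\<phi> n x))"
    by (intro ereal_liminf_lim_add) auto
  then show ?thesis by simp
qed

text \<open>
  A bound \<open>liminf \<phi> < c\<close> at one point propagates to its dense orbit, where it says that the
  open condition \<open>\<phi> n < c\<close> holds for arbitrarily large \<open>n\<close>. That condition therefore defines a dense
  \<open>G\<^sub>\<delta>\<close> set. Points of that set satisfy only the weak bound, since values below \<open>c\<close> may tend to \<open>c\<close>.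
\<close>

lemma residual_liminf_le:
  fixes \<phi> :: "nat \<Rightarrow> 'a::topological_space \<Rightarrow> real"
  assumes minimal: "minimal_map f"
    and cont: "\<And>n. continuous_on UNIV (\<phi> n)"
    and invariant: "\<And>x. (\<lambda>n. \<phi> n (f x) - \<phi> n x) \<longlonglongrightarrow> 0"
    and below: "liminf (\<lambda>n. ereal (\<phi> n x\<^sub>0)) < ereal c"
  shows "residual {x. liminf (\<lambda>n. ereal (\<phi> n x)) \<le> ereal c}"
proof -
  define U where "U N = (\<Union>n\<in>{N..}. {x. \<phi> n x < c})" for N
  have "open (U N)" for N
    unfolding U_def by (intro open_UN ballI open_Collect_less cont continuous_on_const)
  moreover have "closure (U N) = UNIV" for N
  proof -
    have "(f ^^ k) x\<^sub>0 \<in> U N" for k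
    proof (rule ccontr)
      assume "(f ^^ k) x\<^sub>0 \<notin> U N"
      then have "\<forall>\<^sub>F n in sequentially. ereal c \<le> ereal (\<phi> n ((f ^^ k) x\<^sub>0))"
        unfolding U_def eventually_sequentially by (intro exI[of _ N]) (auto simp: not_less)
      then have "ereal c \<le> liminf (\<lambda>n. ereal (\<phi> n ((f ^^ k) x\<^sub>0)))"
        by (rule Liminf_bounded)
      then show False
        using below by (simp add: liminf_constant_on_orbit[where \<phi> = \<phi> and f = f, OF invariant])
    qed
    then have "closure (range (\<lambda>k. (f ^^ k) x\<^sub>0)) \<subseteq> closure (U N)"
      by (intro closure_mono) auto
    then show ?thesis
      using minimal by (auto simp: minimal_map_def)
  qed
  moreover have "liminf (\<lambda>n. ereal (\<phi> n x)) \<le> ereal c" if "\<And>N. x \<in> U N" for x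
  proof (rule ccontr)
    assume "\<not> ?thesis"
    then have "\<forall>\<^sub>F n in sequentially. ereal c < ereal (\<phi> n x)"
      by (intro less_LiminfD) auto
    then obtain N where "\<forall>n\<ge>N. c < \<phi> n x"
      by (auto simp: eventually_sequentially)
    then show False
      using that[of N] unfolding U_def by force
  qed
  ultimately show ?thesis
    unfolding residual_def by (intro exI[of _ "range U"]) auto
qed

lemma residual_limsup_ge:
  fixes \<phi> :: "nat \<Rightarrow> 'a::topological_space \<Rightarrow> real"
  assumes "minimal_map f"
    and cont: "\<And>n. continuous_on UNIV (\<phi> n)"
    and invariant: "\<And>x. (\<lambda>n. \<phi> n (f x) - \<phi> n x) \<longlonglongrightarrow> 0"
    and above: "ereal c < limsup (\<lambda>n. ereal (\<phi> n x\<^sub>0))"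
  shows "residual {x. ereal c \<le> limsup (\<lambda>n. ereal (\<phi> n x))}"
proof -
  have minus: "liminf (\<lambda>n. ereal (- \<phi> n x)) = - limsup (\<lambda>n. ereal (\<phi> n x))" for x
    using ereal_Liminf_uminus[of sequentially "\<lambda>n. ereal (\<phi> n x)"] by simp
  have "residual {x. liminf (\<lambda>n. ereal (- \<phi> n x)) \<le> ereal (- c)}"
  proof (rule residual_liminf_le[OF assms(1), where x\<^sub>0 = x\<^sub>0])
    show "continuous_on UNIV (\<lambda>x. - \<phi> n x)" for n
      by (intro continuous_on_minus cont)
    show "(\<lambda>n. - \<phi> n (f x) - - \<phi> n x) \<longlonglongrightarrow> 0" for x
      using tendsto_minus[OF invariant[of x]] by simp
    show "liminf (\<lambda>n. ereal (- \<phi> n x\<^sub>0)) < ereal (- c)"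
      unfolding minus using above by (simp flip: uminus_ereal.simps)
  qed
  then show ?thesis
    unfolding minus by (simp flip: uminus_ereal.simps)
qed

text \<open>
  If the infimum of all lower limits is not less than the supremum of all upper limits, all
  these numbers coincide, and the uniform bound makes the common value finite. Otherwise two
  numbers fit strictly between them and separate the lower from the upper limits on a residual set.
\<close>

lemma common_limit_or_residual_oscillation:
  fixes \<phi> :: "nat \<Rightarrow> 'a::topological_space \<Rightarrow> real"
  assumes "minimal_map f"
    and "\<And>n. continuous_on UNIV (\<phi> n)"
    and "\<And>x. (\<lambda>n. \<phi> n (f x) - \<phi> n x) \<longlonglongrightarrow> 0"
    and bounded: "\<And>n x. \<bar>\<phi> n x\<bar> \<le> C"
  shows "(\<exists>L::real. \<forall>x. (\<lambda>n. \<phi> n x) \<longlonglongrightarrow> L)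
    \<or> residual {x. liminf (\<lambda>n. ereal (\<phi> n x)) < limsup (\<lambda>n. ereal (\<phi> n x))}"
proof -
  define l where "l x = liminf (\<lambda>n. ereal (\<phi> n x))" for x
  define u where "u x = limsup (\<lambda>n. ereal (\<phi> n x))" for x
  have l_le_u: "l x \<le> u x" for x
    unfolding l_def u_def by (intro Liminf_le_Limsup) simp
  show ?thesis
  proof (cases "(INF x. l x) < (SUP x. u x)")
    case True
    then obtain c where c: "(INF x. l x) < ereal c" "ereal c < (SUP x. u x)"
      by (rule ereal_dense2[THEN exE]) auto
    obtain d where d: "ereal c < ereal d" "ereal d < (SUP x. u x)"
      using ereal_dense2[OF c(2)] by auto
    obtain x\<^sub>0 y\<^sub>0 where "l x\<^sub>0 < ereal c" "ereal d < u y\<^sub>0"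
      using c(1) d(2) by (auto simp: INF_less_iff less_SUP_iff)
    then have "residual ({x. l x \<le> ereal c} \<inter> {x. ereal d \<le> u x})"
      unfolding l_def u_def
      by (intro residual_Int residual_liminf_le[where f = f] residual_limsup_ge[where f = f] assms)
    then have "residual {x. l x < u x}"
      by (rule residual_mono) (use d(1) in \<open>auto intro: le_less_trans[OF _ less_le_trans[of "ereal c" "ereal d"]]\<close>)
    then show ?thesis
      unfolding l_def u_def by simp
  next
    case False
    define L where "L = (SUP x. u x)"
    have "l x = L \<and> u x = L" for x
    proof -
      have "L \<le> l x"
        using False by (auto simp: L_def not_less intro: order_trans[OF _ INF_lower])
      moreover have "u x \<le> L"
        unfolding L_def by (rule SUP_upper) simp
      ultimately show ?thesis
        using l_le_u[of x] by (auto intro: antisym)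
    qed
    then have lim: "(\<lambda>n. ereal (\<phi> n x)) \<longlonglongrightarrow> L" for x
      by (intro Liminf_eq_Limsup) (auto simp: l_def u_def)
    have "ereal (- C) \<le> L" "L \<le> ereal C"
      using bounded[of _ undefined]
      by (auto intro!: tendsto_lowerbound[OF lim[of undefined]] tendsto_upperbound[OF lim[of undefined]]
          always_eventually simp: abs_le_iff minus_le_iff)
    then obtain r where "L = ereal r"
      by (cases L) auto
    then show ?thesis
      using lim by auto
  qed
qed

section \<open>The growth rate of a matrix cocycle\<close>

lemma onorm_matrix_pos:
  fixes B :: "real^'n^'n"
  assumes "invertible B"
  shows "0 < onorm ((*v) B)"
proof -
  have "B *v v \<noteq> 0" if "v \<noteq> 0" for v
    using assms that by (metis inj_matrix_vector_mult injD matrix_vector_mult_0_right)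
  then have "\<not> (\<forall>v. B *v v = 0)"
    by (metis zero_neq_one)
  then show ?thesis
    using onorm_pos_lt[of "(*v) B"] by simp
qed

lemma continuous_onorm_matrix:
  "continuous_on UNIV (\<lambda>B :: real^'n^'m. onorm ((*v) B))"
proof -
  have "(\<lambda>B. onorm ((*v) B)) \<midarrow>B\<^sub>0\<rightarrow> onorm ((*v) B\<^sub>0)" for B\<^sub>0 :: "real^'n^'m"
  proof -
    have diff: "\<bar>onorm ((*v) B) - onorm ((*v) B\<^sub>0)\<bar> \<le> (\<Sum>i\<in>UNIV. \<Sum>j\<in>UNIV. \<bar>(B - B\<^sub>0) $ i $ j\<bar>)"
      for B :: "real^'n^'m"
    proof -
      have le: "onorm ((*v) P) - onorm ((*v) Q) \<le> onorm ((*v) (P - Q))" for P Q :: "real^'n^'m"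
      proof -
        have "onorm ((*v) P) = onorm (\<lambda>v. (P - Q) *v v + Q *v v)"
          by (simp flip: matrix_vector_mult_add_rdistrib)
        then show ?thesis
          using onorm_triangle[of "(*v) (P - Q)" "(*v) Q"] by simp
      qed
      have "onorm ((*v) (B\<^sub>0 - B)) = onorm (\<lambda>v. - ((B - B\<^sub>0) *v v))"
        by (simp add: matrix_vector_mult_diff_rdistrib[abs_def])
      also have "\<dots> = onorm ((*v) (B - B\<^sub>0))"
        by (rule onorm_neg)
      finally have "\<bar>onorm ((*v) B) - onorm ((*v) B\<^sub>0)\<bar> \<le> onorm ((*v) (B - B\<^sub>0))"
        using le[of B B\<^sub>0] le[of B\<^sub>0 B] by linarith
      also have "\<dots> \<le> (\<Sum>i\<in>UNIV. \<Sum>j\<in>UNIV. \<bar>(B - B\<^sub>0) $ i $ j\<bar>)"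
        by (rule onorm_le_matrix_component_sum)
      finally show ?thesis .
    qed
    have "(\<lambda>B. \<Sum>i\<in>UNIV. \<Sum>j\<in>UNIV. \<bar>(B - B\<^sub>0) $ i $ j\<bar>)
        \<midarrow>B\<^sub>0\<rightarrow> (\<Sum>i\<in>UNIV. \<Sum>j\<in>UNIV. \<bar>(B\<^sub>0 - B\<^sub>0) $ i $ j\<bar>)"
      by (intro tendsto_intros)
    then have "(\<lambda>B. \<Sum>i\<in>UNIV. \<Sum>j\<in>UNIV. \<bar>(B - B\<^sub>0) $ i $ j\<bar>) \<midarrow>B\<^sub>0\<rightarrow> 0"
      by simp
    then have "(\<lambda>B. onorm ((*v) B) - onorm ((*v) B\<^sub>0)) \<midarrow>B\<^sub>0\<rightarrow> 0"
      by (rule Lim_null_comparison[rotated]) (intro always_eventually allI, unfold real_norm_def, rule diff)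
    then show ?thesis
      by (rule LIM_zero_cancel)
  qed
  then show ?thesis
    by (simp add: continuous_on_def)
qed

lemma cocycle_Suc_right: "cocycle A f (Suc n) x = cocycle A f n (f x) ** A x"
proof (induction n)
  case (Suc n)
  have "cocycle A f (Suc (Suc n)) x = A ((f ^^ n) (f x)) ** cocycle A f (Suc n) x"
    by (simp add: funpow_swap1)
  then show ?case
    unfolding Suc by (simp add: matrix_mul_assoc)
qed (simp)

lemma invertible_cocycle:
  assumes "\<And>x. invertible (A x)"
  shows "invertible (cocycle A f n x)"
proof (induction n)
  case 0
  show ?case
    unfolding cocycle.simps invertible_def by (intro exI[of _ "mat 1"]) simp
next
  case (Suc n)
  then show ?case
    unfolding cocycle.simps by (intro invertible_mult assms)
qed

lemma continuous_on_cocycle: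
  fixes f :: "'a::topological_space \<Rightarrow> 'a"
  assumes "continuous_on UNIV f" "continuous_on UNIV A"
  shows "continuous_on UNIV (cocycle A f n)"
proof -
  have iterate: "continuous_on UNIV (f ^^ n)" for n
    by (induction n) (auto intro: continuous_on_compose2[OF assms(1)] simp: o_def)
  show ?thesis
  proof (induction n)
    case (Suc n)
    have "continuous_on UNIV (\<lambda>x. A ((f ^^ n) x) ** cocycle A f n x)"
      unfolding matrix_matrix_mult_def
      by (intro continuous_intros continuous_on_compose2[OF assms(2) iterate] Suc) auto
    then show ?case by simp
  qed (simp add: cocycle.simps(1)[abs_def])
qed

lemma continuous_on_growth_rate:
  fixes f :: "'a::topological_space \<Rightarrow> 'a"
  assumes "continuous_on UNIV f" "continuous_on UNIV A" "\<And>x. invertible (A x)"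
  shows "continuous_on UNIV (\<lambda>x. growth_rate A f x n)"
  unfolding growth_rate_def
proof (intro continuous_intros)
  show "continuous_on UNIV (\<lambda>x. onorm ((*v) (cocycle A f n x)))"
    by (rule continuous_on_compose2[OF continuous_onorm_matrix continuous_on_cocycle])
      (use assms in auto)
  show "\<forall>x\<in>UNIV. onorm ((*v) (cocycle A f n x)) \<noteq> 0"
    by (intro ballI less_imp_neq[THEN not_sym] onorm_matrix_pos invertible_cocycle assms(3))
qed

text \<open>
  The expansion of a unit vector is a continuous positive function on the compact product of the
  base with the unit sphere, so it has a positive minimum.
\<close>

lemma uniform_expansion_bounds:
  fixes A :: "'a::topological_space \<Rightarrow> real^'n^'n"
  assumes "compact (UNIV :: 'a set)" "continuous_on UNIV A" "\<And>x. invertible (A x)"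
  obtains m M where "0 < m" "0 < M"
    "\<And>x v. m * norm v \<le> norm (A x *v v)" "\<And>x v. norm (A x *v v) \<le> M * norm v"
proof -
  define K where "K = (UNIV :: 'a set) \<times> sphere (0 :: real^'n) 1"
  define g where "g p = norm (A (fst p) *v snd p)" for p
  have "compact K"
    unfolding K_def by (intro compact_Times assms compact_sphere)
  have "axis undefined 1 \<in> sphere (0 :: real^'n) 1"
    by simp
  then have "K \<noteq> {}"
    unfolding K_def by blast
  have cont: "continuous_on K g"
    unfolding g_def matrix_vector_mult_def
    by (intro continuous_intros continuous_on_compose2[OF assms(2)]) auto
  have pos: "0 < g p" if "p \<in> K" for p
  proof -
    have "snd p \<noteq> 0"
      using that by (auto simp: K_def)
    then have "A (fst p) *v snd p \<noteq> 0"
      by (metis assms(3) inj_matrix_vector_mult injD matrix_vector_mult_0_right)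
    then show ?thesis by (simp add: g_def)
  qed
  obtain p where p: "p \<in> K" "\<And>q. q \<in> K \<Longrightarrow> g p \<le> g q"
    using continuous_attains_inf[OF \<open>compact K\<close> \<open>K \<noteq> {}\<close> cont] by blast
  obtain q where q: "q \<in> K" "\<And>r. r \<in> K \<Longrightarrow> g r \<le> g q"
    using continuous_attains_sup[OF \<open>compact K\<close> \<open>K \<noteq> {}\<close> cont] by blast
  have bounds: "g p * norm v \<le> norm (A x *v v) \<and> norm (A x *v v) \<le> g q * norm v" for x v
  proof (cases "v = 0")
    case False
    define w where "w = v /\<^sub>R norm v"
    have "(x, w) \<in> K"
      using False by (simp add: K_def w_def)
    moreover have "norm (A x *v v) = g (x, w) * norm v"
      using False by (simp add: g_def w_def matrix_vector_mult_scaleR)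
    ultimately show ?thesis
      using p(2) q(2) by (simp add: mult_right_mono)
  qed simp
  show ?thesis
    by (rule that[of "g p" "g q"]) (use bounds pos p(1) q(1) in auto)
qed

text \<open>
  For a product with a matrix on the right, the lower bound uses surjectivity: every vector is
  the image of one that is longer by a factor of at most \<open>1 / m\<close>.
\<close>

lemma onorm_matrix_mult_bounds:
  fixes B P :: "real^'n^'n"
  assumes "invertible P" "0 < m" "0 < M"
    and lower: "\<And>v. m * norm v \<le> norm (P *v v)" and upper: "\<And>v. norm (P *v v) \<le> M * norm v"
  shows "m * onorm ((*v) B) \<le> onorm ((*v) (P ** B))" "onorm ((*v) (P ** B)) \<le> M * onorm ((*v) B)"
    and "m * onorm ((*v) B) \<le> onorm ((*v) (B ** P))" "onorm ((*v) (B ** P)) \<le> M * onorm ((*v) B)"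
proof -
  have apply_le: "norm (Q *v v) \<le> onorm ((*v) Q) * norm v" for Q :: "real^'n^'n" and v
    by (rule onorm) simp
  have "norm (B *v v) \<le> onorm ((*v) (P ** B)) / m * norm v" for v
  proof -
    have "m * norm (B *v v) \<le> onorm ((*v) (P ** B)) * norm v"
      using lower[of "B *v v"] apply_le[of "P ** B" v] by (simp flip: matrix_vector_mul_assoc)
    then show ?thesis
      using \<open>0 < m\<close> by (simp add: field_simps)
  qed
  from onorm_le[of "(*v) B", OF this] show "m * onorm ((*v) B) \<le> onorm ((*v) (P ** B))"
    using \<open>0 < m\<close> by (simp add: field_simps)
  have "norm ((P ** B) *v v) \<le> M * onorm ((*v) B) * norm v" for v
  proof -
    have "norm ((P ** B) *v v) \<le> M * norm (B *v v)"
      using upper[of "B *v v"] by (simp flip: matrix_vector_mul_assoc)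
    also have "\<dots> \<le> M * (onorm ((*v) B) * norm v)"
      using apply_le \<open>0 < M\<close> by simp
    finally show ?thesis by (simp add: mult.assoc)
  qed
  then show "onorm ((*v) (P ** B)) \<le> M * onorm ((*v) B)"
    by (rule onorm_le)
  have "norm (B *v v) \<le> onorm ((*v) (B ** P)) / m * norm v" for v
  proof -
    obtain w where v: "v = P *v w"
      using \<open>invertible P\<close> unfolding invertible_def by (metis matrix_vector_mul_assoc matrix_vector_mul_lid)
    have "m * norm (B *v v) \<le> m * (onorm ((*v) (B ** P)) * norm w)"
      using apply_le[of "B ** P" w] \<open>0 < m\<close> by (simp add: v flip: matrix_vector_mul_assoc)
    also have "\<dots> = onorm ((*v) (B ** P)) * (m * norm w)"
      by simp
    also have "\<dots> \<le> onorm ((*v) (B ** P)) * norm v"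
      unfolding v by (intro mult_left_mono lower onorm_pos_le) simp
    finally show ?thesis
      using \<open>0 < m\<close> by (simp add: field_simps)
  qed
  from onorm_le[of "(*v) B", OF this] show "m * onorm ((*v) B) \<le> onorm ((*v) (B ** P))"
    using \<open>0 < m\<close> by (simp add: field_simps)
  have "norm ((B ** P) *v v) \<le> M * onorm ((*v) B) * norm v" for v
  proof -
    have "norm ((B ** P) *v v) \<le> onorm ((*v) B) * norm (P *v v)"
      using apply_le[of B "P *v v"] by (simp flip: matrix_vector_mul_assoc)
    also have "\<dots> \<le> onorm ((*v) B) * (M * norm v)"
      by (intro mult_left_mono upper onorm_pos_le) simp
    finally show ?thesis by (simp add: mult_ac)
  qed
  then show "onorm ((*v) (B ** P)) \<le> M * onorm ((*v) B)"
    by (rule onorm_le)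
qed

lemma abs_diff_ln_le:
  fixes m M a b :: real
  assumes "0 < m" "0 < M" "0 < a" "m * a \<le> b" "b \<le> M * a"
  shows "\<bar>ln b - ln a\<bar> \<le> \<bar>ln m\<bar> + \<bar>ln M\<bar>"
proof -
  have "0 < b"
    using assms by (smt (verit) mult_pos_pos)
  have "ln (m * a) \<le> ln b" "ln b \<le> ln (M * a)"
    using assms \<open>0 < b\<close> by (simp_all add: ln_le_cancel_iff)
  then show ?thesis
    using assms by (simp add: ln_mult)
qed

text \<open>
  Both bounds come from comparing \<open>a (n + 1) x\<close> with \<open>a n x\<close> (one factor fewer on the left) and
  with \<open>a n (f x)\<close> (one factor fewer on the right): each changes the logarithm by at most
  \<open>C\<close>. Summing the first over \<open>n\<close> bounds the growth rate; combining the two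
  moves the base point from \<open>x\<close> to \<open>f x\<close> without changing the number of factors.
\<close>

lemma growth_rate_bounds:
  fixes f :: "'a::topological_space \<Rightarrow> 'a" and A :: "'a \<Rightarrow> real^'k^'k"
  assumes "compact (UNIV :: 'a set)" "continuous_on UNIV A" and inv: "\<And>x. invertible (A x)"
  obtains C where "\<And>x n. \<bar>growth_rate A f x n\<bar> \<le> C"
    and "\<And>x n. \<bar>growth_rate A f (f x) n - growth_rate A f x n\<bar> \<le> 2 * C / real n"
proof -
  obtain m M where mM: "0 < m" "0 < M"
    "\<And>x v. m * norm v \<le> norm (A x *v v)" "\<And>x v. norm (A x *v v) \<le> M * norm v"
    using uniform_expansion_bounds[OF assms] by blast
  define C where "C = \<bar>ln m\<bar> + \<bar>ln M\<bar>"
  define a where "a n x = ln (onorm ((*v) (cocycle A f n x)))" for n x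
  note pos = onorm_matrix_pos[OF invertible_cocycle[OF inv]]
  note mult_bounds = onorm_matrix_mult_bounds[OF inv mM]
  have left: "\<bar>a (Suc n) x - a n x\<bar> \<le> C" for n x
    unfolding a_def C_def cocycle.simps(2) by (intro abs_diff_ln_le mM(1,2) pos mult_bounds(1,2))
  have right: "\<bar>a (Suc n) x - a n (f x)\<bar> \<le> C" for n x
    unfolding a_def C_def cocycle_Suc_right
    by (intro abs_diff_ln_le mM(1,2) pos mult_bounds(3,4))
  have linear: "\<bar>a n x\<bar> \<le> C * real n" for n x
  proof (induction n)
    case 0
    have "(*v) (mat 1 :: real^'k^'k) = (\<lambda>v. v)"
      by auto
    then show ?case
      by (simp add: a_def onorm_id[unfolded id_def])
  next
    case (Suc n)
    then show ?case
      using left[of n x] by (simp add: algebra_simps abs_le_iff)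
  qed
  have growth: "growth_rate A f x n = a n x / real n" for x n
    by (simp add: growth_rate_def a_def)
  have "0 \<le> C" by (simp add: C_def)
  show ?thesis
  proof (rule that[of C])
    fix x n
    show "\<bar>growth_rate A f x n\<bar> \<le> C"
      using linear[of n x] \<open>0 \<le> C\<close> by (cases "n = 0") (simp_all add: growth abs_divide divide_le_eq)
    have "\<bar>a n (f x) - a n x\<bar> \<le> 2 * C"
      using left[of n x] right[of n x] by linarith
    then show "\<bar>growth_rate A f (f x) n - growth_rate A f x n\<bar> \<le> 2 * C / real n"
      unfolding growth by (simp add: divide_right_mono flip: diff_divide_distrib)
  qed
qed

lemma growth_rate_asymptotically_invariant:
  fixes f :: "'a::topological_space \<Rightarrow> 'a" and A :: "'a \<Rightarrow> real^'k^'k"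
  assumes "compact (UNIV :: 'a set)" "continuous_on UNIV A" "\<And>x. invertible (A x)"
  shows "(\<lambda>n. growth_rate A f (f x) n - growth_rate A f x n) \<longlonglongrightarrow> 0"
proof -
  obtain C where
    "\<And>x n. \<bar>growth_rate A f (f x) n - growth_rate A f x n\<bar> \<le> 2 * C / real n"
    using growth_rate_bounds[OF assms] by metis
  then show ?thesis
    by (intro Lim_null_comparison[OF always_eventually lim_const_over_n]) auto
qed

section \<open>The dichotomy\<close>

theorem corollary7:
  fixes f :: "'a::metric_space \<Rightarrow> 'a"
    and A :: "'a \<Rightarrow> real^'k^'k"
  assumes "compact (UNIV :: 'a set)"
    and "continuous_on UNIV f"
    and "minimal_map f"
    and "CARD('k) \<ge> 2"
    and "continuous_on UNIV A"
    and "\<And>x. invertible (A x)"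
  shows "((\<forall>x. convergent (growth_rate A f x)) \<and>
      (\<exists>L::real.
         (INF x. ereal (lim (growth_rate A f x))) = ereal L \<and>
         (SUP x. ereal (lim (growth_rate A f x))) = ereal L \<and>
         (\<forall>\<mu>. invariant_prob f \<mu> \<longrightarrow>
            (AE x in \<mu>. \<forall>c. largest_exponent_at A f x c \<longleftrightarrow> c = L)) \<and>
         (\<forall>\<mu>. ergodic_prob f \<mu> \<longrightarrow>
            (\<forall>c. largest_exponent A f \<mu> c \<longleftrightarrow> c = L))))
    \<or> (\<exists>R. residual R \<and>
         (\<forall>x\<in>R. liminf (\<lambda>n. ereal (growth_rate A f x n))
                < limsup (\<lambda>n. ereal (growth_rate A f x n))))"
proof -
  obtain C where bounded: "\<And>x n. \<bar>growth_rate A f x n\<bar> \<le> C"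
    using growth_rate_bounds[OF assms(1,5,6)] by metis
  have "(\<exists>L::real. \<forall>x. growth_rate A f x \<longlonglongrightarrow> L)
    \<or> residual {x. liminf (\<lambda>n. ereal (growth_rate A f x n))
                   < limsup (\<lambda>n. ereal (growth_rate A f x n))}"
    by (rule common_limit_or_residual_oscillation[OF assms(3), where C = C])
      (intro continuous_on_growth_rate growth_rate_asymptotically_invariant bounded assms)+
  then show ?thesis
  proof (elim disjE exE)
    fix L :: real
    assume lim: "\<forall>x. growth_rate A f x \<longlonglongrightarrow> L"
    have lim_eq: "lim (growth_rate A f x) = L" for x
      using lim by (intro limI) simp
    have exponent: "largest_exponent_at A f x c \<longleftrightarrow> c = L" for x c
      unfolding largest_exponent_at_def using lim LIMSEQ_unique by blast
    have "largest_exponent A f \<mu> c \<longleftrightarrow> c = L" if "ergodic_prob f \<mu>" for \<mu> c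
    proof -
      interpret prob_space \<mu>
        using that by (simp add: ergodic_prob_def invariant_prob_def)
      show ?thesis
        by (simp add: largest_exponent_def exponent)
    qed
    moreover have "\<forall>x. convergent (growth_rate A f x)"
      using lim by (auto simp: convergent_def)
    ultimately show ?thesis
      by (intro disjI1 conjI exI[of _ L]) (auto simp: lim_eq exponent)
  qed (intro disjI2 exI conjI, assumption, simp)
qed

end
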